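(* Assume that $g$ has no zeros or poles on the unit circle. Suppose $n>\max\left\{\frac{CD}{2(1-\Delta)},\frac{C}{\Delta}\right\}$. Then each of the $2n+4-2Q$ discs $$B_k=\left\{z\in\mathbb{C} : |z-z_k^*|\le\frac{CD}{2(1-\Delta)n^2}\right\},\qquad z_k^*=|g(e^{it_k})|^{\frac1{2n}}e^{it_k},\qquad 1\le k\le 2n+4-2Q,$$ contains a unique root of $H(z)$.
   Context: Let $n\ge1$ be an integer and $b_0,b_1,c_{-1},c_0\in\mathbb{C}$. Define $$H(z)=z^{2n}(b_1+b_0z+z^2)(c_{-1}+c_0z+z^2)-(b_1z^2+b_0z+1)(c_{-1}z^2+c_0z+1),$$ $p(z)=(b_1z^2+b_0z+1)(c_{-1}z^2+c_0z+1)$, and let $g$ be the rational function $g(z)=\dfrac{p(z)}{z^4p(z^{-1})}=\dfrac{(b_1z^2+b_0z+1)(c_{-1}z^2+c_0z+1)}{(b_1+b_0z+z^2)(c_{-1}+c_0z+z^2)}$. Differentiable functions $R,\Psi:\mathbb{R}\to\mathbb{R}$ are defined by requiring $g(e^{it})=R(t)e^{i\Psi(t)}$, with $R(t)=|g(e^{it})|$. A number $t\in[0,2\pi)$ is called a phase root if $e^{2int}=e^{i\Psi(t)}$. $Q$ is the number of zeros of $p$, with multiplicity, inside the unit circle. The constants: $0<\Delta<1$, $A_\Delta=\{z\in\mathbb{C}: 1-\Delta<|z|<1+\Delta\}$, and $C>1$, $D>0$ are chosen so that on $A_\Delta$ one has $C^{-1}<|g(z)|<C$ and $|g'(z)|<D$.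 For $n>CD/2$ there are exactly $2n+4-2Q$ phase roots in $[0,2\pi)$; they are denoted $t_1<t_2<\dots<t_{2n+4-2Q}$. *)

theory Defs
  imports "HOL-Analysis.Analysis" "HOL-Computational_Algebra.Polynomial"
begin

text \<open>The parameters \<open>b0\<close>, \<open>b1\<close>, \<open>cm1\<close>, \<open>c0\<close> are
  $b_0$, $b_1$, $c_{-1}$, $c_0$.\<close>

definition H :: "complex \<Rightarrow> complex \<Rightarrow> complex \<Rightarrow> complex \<Rightarrow> nat \<Rightarrow> complex \<Rightarrow> complex" where
  "H b0 b1 cm1 c0 n z =
     z ^ (2 * n) * (b1 + b0 * z + z\<^sup>2) * (cm1 + c0 * z + z\<^sup>2)
     - (b1 * z\<^sup>2 + b0 * z + 1) * (cm1 * z\<^sup>2 + c0 * z + 1)"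

definition p :: "complex \<Rightarrow> complex \<Rightarrow> complex \<Rightarrow> complex \<Rightarrow> complex poly" where
  "p b0 b1 cm1 c0 = [:1, b0, b1:] * [:1, c0, cm1:]"

definition p_rev :: "complex \<Rightarrow> complex \<Rightarrow> complex \<Rightarrow> complex \<Rightarrow> complex poly" where
  "p_rev b0 b1 cm1 c0 = [:b1, b0, 1:] * [:cm1, c0, 1:]"

lemma poly_p: "poly (p b0 b1 cm1 c0) z = (b1 * z\<^sup>2 + b0 * z + 1) * (cm1 * z\<^sup>2 + c0 * z + 1)"
  by (simp add: p_def power2_eq_square algebra_simps)

lemma poly_p_rev: "poly (p_rev b0 b1 cm1 c0) z = (b1 + b0 * z + z\<^sup>2) * (cm1 + c0 * z + z\<^sup>2)"
  by (simp add: p_rev_def power2_eq_square algebra_simps)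

lemma poly_p_rev_eq:
  assumes "z \<noteq> 0"
  shows "poly (p_rev b0 b1 cm1 c0) z = z ^ 4 * poly (p b0 b1 cm1 c0) (inverse z)"
proof -
  have "z ^ 4 * poly (p b0 b1 cm1 c0) (inverse z) =
      (z\<^sup>2 * (b1 * (inverse z)\<^sup>2 + b0 * inverse z + 1)) *
      (z\<^sup>2 * (cm1 * (inverse z)\<^sup>2 + c0 * inverse z + 1))"
    by (simp add: poly_p power4_eq_xxxx power2_eq_square mult_ac)
  also have "\<dots> = poly (p_rev b0 b1 cm1 c0) z"
    using assms by (simp add: poly_p_rev field_simps power2_eq_square)
  finally show ?thesis by simp
qed

text \<open>The pointwise quotient, in which common factors of \<open>p\<close> and \<open>p_rev\<close> are not
  cancelled. By the convention \<open>x / 0 = 0\<close>, any \<open>z\<close> with \<open>g z \<noteq> 0\<close> is a root of neither.\<close>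

definition g :: "complex \<Rightarrow> complex \<Rightarrow> complex \<Rightarrow> complex \<Rightarrow> complex \<Rightarrow> complex" where
  "g b0 b1 cm1 c0 z = poly (p b0 b1 cm1 c0) z / poly (p_rev b0 b1 cm1 c0) z"

text \<open>The set summed over is finite, since \<open>p\<close> takes the value \<open>1\<close> at \<open>0\<close>.\<close>

definition Q :: "complex \<Rightarrow> complex \<Rightarrow> complex \<Rightarrow> complex \<Rightarrow> nat" where
  "Q b0 b1 cm1 c0 =
     (\<Sum>z | poly (p b0 b1 cm1 c0) z = 0 \<and> cmod z < 1. order z (p b0 b1 cm1 c0))"

definition annulus :: "real \<Rightarrow> complex set" where
  "annulus \<Delta> = {z. 1 - \<Delta> < cmod z \<and> cmod z < 1 + \<Delta>}"

definition phase_roots :: "nat \<Rightarrow> (real \<Rightarrow> real) \<Rightarrow> real set" where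
  "phase_roots n \<Psi> = {t \<in> {0..<2 * pi}. cis (2 * real n * t) = cis (\<Psi> t)}"

definition z_star :: "complex \<Rightarrow> complex \<Rightarrow> complex \<Rightarrow> complex \<Rightarrow> nat \<Rightarrow> real \<Rightarrow> complex" where
  "z_star b0 b1 cm1 c0 n t =
     of_real (cmod (g b0 b1 cm1 c0 (cis t)) powr (1 / (2 * real n))) * cis t"

end

theory Submission
  imports Defs
begin

text \<open>
  In the annulus neither \<open>p\<close> nor \<open>p_rev\<close> vanishes, and the roots of \<open>H\<close> are the solutions of
  \<open>z ^ (2n) = g z\<close>. Two facts are needed: how many phase roots there are, and that each of them is close
  to exactly one solution.

  Number of phase roots. Phase roots are the points where \<open>2 n t - \<Psi> t\<close> is a multiple of \<open>2 \<pi>\<close>. The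
  bounds on \<open>g\<close> and \<open>g'\<close> give \<open>\<bar>\<Psi>'\<bar> < C D\<close> (\<open>phase_derivative_bound\<close>) and \<open>C D < 2 n\<close> by the choice of \<open>n\<close>,
  so this function is strictly increasing. Writing \<open>g\<close> as a product of four factors
  \<open>(1 - \<alpha> z) / (z - \<alpha>)\<close>, each of which winds once around the origin in a direction that depends on whether \<open>1 / \<alpha>\<close> is inside the circle, shows
  \<open>\<Psi> (2 \<pi>) - \<Psi> 0 = 2 \<pi> (2 Q - 4)\<close> (\<open>phase_increment\<close>). The total increase is thus
  \<open>2 \<pi> (2 n + 4 - 2 Q)\<close>, and the intermediate value theorem lists the phase roots
  (\<open>enumerate_integer_crossings\<close>).

  One root per disc. Near \<open>u = cis t\<close>, with \<open>t\<close> a phase root, let \<open>F\<close> be the branch of \<open>g powr (1 / (2n))\<close>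
  whose value at \<open>u\<close> is the centre \<open>z_star\<close>. Fixed points of \<open>F\<close> are roots of \<open>H\<close>. If \<open>\<bar>F'\<bar> \<le> K < 1\<close> on a disc
  around \<open>u\<close> that contains the given disc of radius \<open>r\<close>, and \<open>K (\<bar>z_star - u\<bar> + r) \<le> r\<close>, then \<open>F\<close> maps
  the given disc into itself and has a unique fixed point there. A root in the disc that is not fixed
  by \<open>F\<close> would differ from its image by a factor that is a nontrivial \<open>2n\<close>-th root of unity, which
  moves it too far (\<open>unique_solution_power_eq\<close>).

  The delicate point is the constant \<open>K\<close>. The obvious bound \<open>C D / (2 n)\<close> suffices for
  \<open>C \<le> (1 + \<Delta>) / (1 - \<Delta>)\<close>. For larger \<open>C\<close> the identity \<open>g z * g (1 / z) = 1\<close> helps: where \<open>\<bar>g\<bar>\<close> is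
  small, \<open>g'\<close> is small as well, because otherwise \<open>g'\<close> would exceed \<open>D\<close> at \<open>1 / z\<close> (\<open>norm_deriv_g_inverse\<close>). This removes the
  factor \<open>C\<close> from the estimate. The two cases are joined in \<open>unique_root_in_disc\<close>.
\<close>

section \<open>The winding of the phase around the unit circle\<close>

text \<open>Each linear factor of \<open>p\<close>, divided by its reversal, winds exactly once around \<open>0\<close> along the
  unit circle. Pulling \<open>cis t\<close> out of whichever of \<open>1 - \<alpha> * cis t\<close> and \<open>cis t - \<alpha>\<close> winds, and cancelling
  a common factor \<open>- \<alpha>\<close> if \<open>\<bar>\<alpha>\<bar> > 1\<close>, leaves numbers in the right half plane, whose principal logarithms
  are continuous and periodic; \<open>q\<close> is their difference.\<close>
lemma blaschke_factor_phase:
  fixes \<alpha> :: complex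
  assumes "cmod \<alpha> \<noteq> 1"
  obtains q :: "real \<Rightarrow> complex"
  where "continuous_on UNIV q" "q (2 * pi) = q 0"
    "\<And>t. (1 - \<alpha> * cis t) / (cis t - \<alpha>)
          = exp (q t + \<i> * of_real (if cmod \<alpha> > 1 then t else - t))"
proof (cases "cmod \<alpha> > 1")
  case False
  then have a: "cmod \<alpha> < 1" using assms by simp
  have pos: "1 - \<alpha> * cis t \<notin> \<real>\<^sub>\<le>\<^sub>0" for t
  proof -
    have "Re (\<alpha> * cis t) \<le> cmod (\<alpha> * cis t)" by (rule complex_Re_le_cmod)
    then have "Re (1 - \<alpha> * cis t) > 0" using a by (simp add: norm_mult)
    then show ?thesis by (auto simp: complex_nonpos_Reals_iff)
  qed
  have nz: "1 - \<alpha> * cis t \<noteq> 0" for t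
    using pos[of t] by auto
  define q where "q t = Ln (1 - \<alpha> * cis t) - Ln (1 - \<alpha> * cis (- t))" for t
  have "continuous_on UNIV q"
    unfolding q_def using pos by (intro continuous_intros) auto
  moreover have "q (2 * pi) = q 0"
    by (simp add: q_def cis.code)
  moreover have "(1 - \<alpha> * cis t) / (cis t - \<alpha>)
      = exp (q t + \<i> * of_real (if cmod \<alpha> > 1 then t else - t))" for t
  proof -
    have "cis t - \<alpha> = cis t * (1 - \<alpha> * cis (- t))"
      by (simp add: algebra_simps cis_mult)
    moreover have "exp (q t) = (1 - \<alpha> * cis t) / (1 - \<alpha> * cis (- t))"
      using nz[of t] nz[of "-t"] by (simp add: q_def exp_diff)
    moreover have "cis (- t) = 1 / cis t"
      by (metis cis_inverse inverse_eq_divide)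
    moreover have "exp (q t + \<i> * of_real (- t)) = exp (q t) * cis (- t)"
      by (simp only: exp_add cis_conv_exp)
    ultimately show ?thesis
      using False by simp
  qed
  ultimately show ?thesis using that by blast
next
  case True
  then have a: "cmod (1 / \<alpha>) < 1" and a0: "\<alpha> \<noteq> 0" by (auto simp: norm_divide divide_less_eq)
  have pos: "1 - cis t / \<alpha> \<notin> \<real>\<^sub>\<le>\<^sub>0" for t
  proof -
    have "Re (cis t / \<alpha>) \<le> cmod (cis t / \<alpha>)" by (rule complex_Re_le_cmod)
    then have "Re (1 - cis t / \<alpha>) > 0" using a by (simp add: norm_divide)
    then show ?thesis by (auto simp: complex_nonpos_Reals_iff)
  qed
  have nz: "1 - cis t / \<alpha> \<noteq> 0" for t
    using pos[of t] by auto
  define q where "q t = Ln (1 - cis (- t) / \<alpha>) - Ln (1 - cis t / \<alpha>)" for t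
  have "continuous_on UNIV q"
    unfolding q_def using pos a0 by (intro continuous_intros) auto
  moreover have "q (2 * pi) = q 0"
    by (simp add: q_def cis.code)
  moreover have "(1 - \<alpha> * cis t) / (cis t - \<alpha>)
      = exp (q t + \<i> * of_real (if cmod \<alpha> > 1 then t else - t))" for t
  proof -
    have "cis t * cis (- t) = 1" by (simp add: cis_mult)
    then have 1: "1 - \<alpha> * cis t = (- \<alpha>) * (cis t * (1 - cis (- t) / \<alpha>))"
      using a0 by (simp add: field_simps)
    have 2: "cis t - \<alpha> = (- \<alpha>) * (1 - cis t / \<alpha>)"
      using a0 by (simp add: field_simps)
    have "exp (q t + \<i> * of_real t) = (1 - cis (- t) / \<alpha>) / (1 - cis t / \<alpha>) * cis t"
      using nz[of t] nz[of "-t"] by (simp add: q_def exp_add exp_diff cis_conv_exp)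
    moreover have "(1 - \<alpha> * cis t) / (cis t - \<alpha>) = (cis t * (1 - cis (- t) / \<alpha>)) / (1 - cis t / \<alpha>)"
      unfolding 1 2 using a0 by (subst mult_divide_mult_cancel_left) auto
    ultimately show ?thesis using True by simp
  qed
  ultimately show ?thesis using that by blast
qed

text \<open>Two continuous logarithms of the same curve differ by a continuous function with values in
  the discrete set \<open>2\<pi>\<i>\<int>\<close>, which is constant. This transfers the increment of an explicit
  logarithm to the given phase function, about which nothing but continuity is known.\<close>
lemma exp_lift_unique:
  fixes L1 L2 :: "real \<Rightarrow> complex"
  assumes "continuous_on {a..b} L1" "continuous_on {a..b} L2" "a \<le> b"
    and eq: "\<And>t. t \<in> {a..b} \<Longrightarrow> exp (L1 t) = exp (L2 t)"
  shows "L1 b - L1 a = L2 b - L2 a"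
proof -
  define d where "d t = L1 t - L2 t" for t
  have per: "\<exists>k::int. d t = of_real (2 * of_int k * pi) * \<i>" if "t \<in> {a..b}" for t
    using eq[OF that] by (force simp: exp_eq d_def)
  have "d constant_on {a..b}"
  proof (rule continuous_discrete_range_constant)
    show "continuous_on {a..b} d" unfolding d_def using assms by (intro continuous_intros)
    fix x assume x: "x \<in> {a..b}"
    have "2 * pi \<le> norm (d y - d x)" if y: "y \<in> {a..b}" and ne: "d y \<noteq> d x" for y
    proof -
      obtain j k :: int where j: "d x = of_real (2 * of_int j * pi) * \<i>"
        and k: "d y = of_real (2 * of_int k * pi) * \<i>" using per x y by metis
      have "d y - d x = of_real (2 * pi * of_int (k - j)) * \<i>"
        by (simp add: j k algebra_simps)
      then have "norm (d y - d x) = 2 * pi * \<bar>of_int (k - j)\<bar>"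
        by (simp only: norm_mult norm_of_real norm_ii abs_mult) simp
      moreover have "\<bar>of_int (k - j) :: real\<bar> \<ge> 1" using j k ne by (cases "k = j") auto
      ultimately show ?thesis by (simp add: mult_left_mono)
    qed
    then show "\<exists>e>0. \<forall>y. y \<in> {a..b} \<and> d y \<noteq> d x \<longrightarrow> e \<le> norm (d y - d x)"
      by (intro exI[of _ "2 * pi"]) auto
  qed auto
  then have "d b = d a" using assms(3) by (auto simp: constant_on_def)
  then show ?thesis by (simp add: d_def algebra_simps)
qed

lemma quadratic_linear_factors:
  fixes b0 b1 :: complex
  obtains \<alpha> \<beta> where "[:1, b0, b1:] = [:1, - \<alpha>:] * [:1, - \<beta>:]"
    "[:b1, b0, 1:] = [:- \<alpha>, 1:] * [:- \<beta>, 1:]"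
proof -
  define \<alpha> where "\<alpha> = (csqrt (b0\<^sup>2 - 4 * b1) - b0) / 2"
  have "2 * \<alpha> + b0 = csqrt (b0\<^sup>2 - 4 * b1)" by (simp add: \<alpha>_def field_simps)
  then have "(2 * \<alpha> + b0)\<^sup>2 = b0\<^sup>2 - 4 * b1" by simp
  then have "4 * (b1 + \<alpha> * (b0 + \<alpha>)) = 0" by (simp add: power2_eq_square algebra_simps)
  then have "b1 + \<alpha> * (b0 + \<alpha>) = 0" by (metis mult_eq_0_iff zero_neq_numeral)
  then have "b1 = - \<alpha> * (b0 + \<alpha>)" by (simp add: eq_neg_iff_add_eq_0)
  then show ?thesis
    by (intro that[of \<alpha> "- b0 - \<alpha>"]) (simp_all add: algebra_simps)
qed

lemma Q_eq_size_proots: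
  "Q b0 b1 cm1 c0 = size (filter_mset (\<lambda>z. cmod z < 1) (proots (p b0 b1 cm1 c0)))"
proof -
  have nz: "p b0 b1 cm1 c0 \<noteq> 0"
    by (metis poly_0 poly_p mult_zero_right zero_power2 add_0 mult_1 zero_neq_one)
  show ?thesis
    unfolding Q_def size_multiset_overloaded_eq using nz
    by (intro sum.cong) auto
qed

text \<open>The zero of \<open>1 - \<alpha> z\<close> is \<open>1 / \<alpha>\<close>; for \<open>\<alpha> = 0\<close> there is none, as happens when \<open>p\<close> has degree
  below \<open>4\<close>.\<close>
lemma size_proots_disc_linear:
  fixes \<alpha> :: complex
  shows "size (filter_mset (\<lambda>z. cmod z < 1) (proots [:1, - \<alpha>:])) = (if cmod \<alpha> > 1 then 1 else 0)"
proof (cases "\<alpha> = 0")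
  case False
  then have "[:1, - \<alpha>:] = smult (- \<alpha>) [:- (1 / \<alpha>), 1:]" by simp
  then have "proots [:1, - \<alpha>:] = {#1 / \<alpha>#}"
    using False by (metis proots_smult proots_linear_factor minus_minus neg_equal_0_iff_equal)
  then show ?thesis using False by (auto simp: norm_divide)
qed auto

text \<open>A factor \<open>1 - \<alpha> z\<close> with its zero inside the circle (\<open>\<bar>\<alpha>\<bar> > 1\<close>) contributes one positive turn
  to \<open>g\<close>, a factor without such a zero contributes one negative turn. Of the four factors, \<open>Q\<close> are of
  the first kind and \<open>4 - Q\<close> of the second, so the phase makes \<open>2 Q - 4\<close> turns.\<close>
lemma phase_increment:
  fixes \<Psi> R :: "real \<Rightarrow> real"
  assumes cont: "continuous_on UNIV \<Psi>" "continuous_on UNIV R"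
    and R: "\<And>t. R t = cmod (g b0 b1 cm1 c0 (cis t))"
    and polar: "\<And>t. g b0 b1 cm1 c0 (cis t) = of_real (R t) * cis (\<Psi> t)"
    and nz: "\<And>z. cmod z = 1 \<Longrightarrow> poly (p b0 b1 cm1 c0) z \<noteq> 0 \<and> poly (p_rev b0 b1 cm1 c0) z \<noteq> 0"
  shows "\<Psi> (2 * pi) - \<Psi> 0 = 2 * pi * (2 * real (Q b0 b1 cm1 c0) - 4)"
proof -
  obtain \<alpha> \<beta> where ab: "[:1, b0, b1:] = [:1, - \<alpha>:] * [:1, - \<beta>:]"
    "[:b1, b0, 1:] = [:- \<alpha>, 1:] * [:- \<beta>, 1:]" by (rule quadratic_linear_factors)
  obtain \<gamma> \<delta> where cd: "[:1, c0, cm1:] = [:1, - \<gamma>:] * [:1, - \<delta>:]"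
    "[:cm1, c0, 1:] = [:- \<gamma>, 1:] * [:- \<delta>, 1:]" by (rule quadratic_linear_factors)
  have p: "p b0 b1 cm1 c0 = [:1, - \<alpha>:] * [:1, - \<beta>:] * ([:1, - \<gamma>:] * [:1, - \<delta>:])"
    by (simp only: p_def ab cd)
  have p_rev: "p_rev b0 b1 cm1 c0 = [:- \<alpha>, 1:] * [:- \<beta>, 1:] * ([:- \<gamma>, 1:] * [:- \<delta>, 1:])"
    by (simp only: p_rev_def ab cd)
  have ne1: "cmod x \<noteq> 1" if "x \<in> {\<alpha>, \<beta>, \<gamma>, \<delta>}" for x
    using nz[of x] that unfolding p_rev poly_mult by auto
  define s where "s x t = (if cmod x > 1 then t else - t)" for x :: complex and t :: real
  define e where "e x = (if cmod x > 1 then 1 else 0 :: nat)" for x :: complex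
  have Q: "Q b0 b1 cm1 c0 = e \<alpha> + e \<beta> + e \<gamma> + e \<delta>"
  proof -
    have nz0: "[:1, x:] \<noteq> 0" for x :: complex by simp
    have "proots (p b0 b1 cm1 c0) = proots [:1, - \<alpha>:] + proots [:1, - \<beta>:]
        + (proots [:1, - \<gamma>:] + proots [:1, - \<delta>:])"
      unfolding p by (simp only: proots_mult nz0 mult_eq_0_iff simp_thms)
    then show ?thesis
      unfolding Q_eq_size_proots e_def
      by (simp only: filter_union_mset size_union size_proots_disc_linear)
  qed
  have s_e: "s x t = (2 * real (e x) - 1) * t" for x t
    by (simp add: s_def e_def)
  have "\<exists>q. continuous_on UNIV q \<and> q (2 * pi) = q 0 \<and>
      (\<forall>t. (1 - x * cis t) / (cis t - x) = exp (q t + \<i> * of_real (s x t)))"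
    if "x \<in> {\<alpha>, \<beta>, \<gamma>, \<delta>}" for x
    using blaschke_factor_phase[OF ne1[OF that]] unfolding s_def by metis
  then obtain q where q: "\<And>x. x \<in> {\<alpha>, \<beta>, \<gamma>, \<delta>} \<Longrightarrow> continuous_on UNIV (q x)"
      "\<And>x. x \<in> {\<alpha>, \<beta>, \<gamma>, \<delta>} \<Longrightarrow> q x (pi * 2) = q x 0"
      "\<And>x t. x \<in> {\<alpha>, \<beta>, \<gamma>, \<delta>} \<Longrightarrow>
         (1 - x * cis t) / (cis t - x) = exp (q x t + \<i> * of_real (s x t))"
    by (metis mult.commute)
  have Rpos: "R t > 0" for t
    using nz[of "cis t"] by (simp add: R g_def)
  define L1 where "L1 t = of_real (ln (R t)) + \<i> * of_real (\<Psi> t)" for t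
  define L2 where "L2 t = (q \<alpha> t + \<i> * of_real (s \<alpha> t)) + (q \<beta> t + \<i> * of_real (s \<beta> t))
      + ((q \<gamma> t + \<i> * of_real (s \<gamma> t)) + (q \<delta> t + \<i> * of_real (s \<delta> t)))" for t
  have "L1 (2 * pi) - L1 0 = L2 (2 * pi) - L2 0"
  proof (rule exp_lift_unique)
    show "continuous_on {0..2 * pi} L1"
      unfolding L1_def using Rpos continuous_on_subset[OF cont(1)] continuous_on_subset[OF cont(2)]
      by (intro continuous_intros) (auto simp: less_imp_neq[symmetric])
    show "continuous_on {0..2 * pi} L2"
      unfolding L2_def s_e using continuous_on_subset[OF q(1)]
      by (intro continuous_intros) auto
    fix t
    have "exp (L2 t) = g b0 b1 cm1 c0 (cis t)"
    proof -
      have "exp (L2 t) = (1 - \<alpha> * cis t) / (cis t - \<alpha>) * ((1 - \<beta> * cis t) / (cis t - \<beta>))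
          * ((1 - \<gamma> * cis t) / (cis t - \<gamma>) * ((1 - \<delta> * cis t) / (cis t - \<delta>)))"
        unfolding L2_def exp_add[of "_ + _" "_ + _"] by (simp add: q(3))
      also have "\<dots> = g b0 b1 cm1 c0 (cis t)"
        unfolding g_def p p_rev poly_mult by (simp add: mult.commute)
      finally show ?thesis .
    qed
    moreover have "exp (L1 t) = g b0 b1 cm1 c0 (cis t)"
      using Rpos[of t] by (simp add: L1_def exp_add polar[of t] cis_conv_exp[of "\<Psi> t"] exp_of_real)
    ultimately show "exp (L1 t) = exp (L2 t)" by simp
  qed auto
  moreover have "R (2 * pi) = R 0"
    by (simp add: R cis.code)
  ultimately have "\<i> * of_real (\<Psi> (2 * pi) - \<Psi> 0) = \<i> * of_real (2 * pi * (2 * real (Q b0 b1 cm1 c0) - 4))"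
    using q(2) by (simp add: L1_def L2_def s_e Q algebra_simps)
  then show ?thesis
    by (metis mult_cancel_left complex_i_not_zero of_real_eq_iff)
qed

section \<open>Enumeration of phase roots\<close>

text \<open>By the intermediate value theorem a strictly increasing continuous function that rises by an
  integer \<open>m\<close> meets exactly \<open>m\<close> consecutive integers on a half-open interval, once each. Indexing the
  crossings by the integers met yields the ordered list directly.\<close>
lemma enumerate_integer_crossings:
  fixes \<phi> :: "real \<Rightarrow> real"
  assumes "a \<le> b" and cont: "continuous_on {a..b} \<phi>"
    and mono: "\<And>x y. a \<le> x \<Longrightarrow> x < y \<Longrightarrow> y \<le> b \<Longrightarrow> \<phi> x < \<phi> y"
    and m: "\<phi> b - \<phi> a = real m"
  obtains t :: "nat \<Rightarrow> real"
  where "strict_mono_on {1..m} t" "t ` {1..m} = {x \<in> {a..<b}. \<phi> x \<in> \<int>}"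
proof -
  define k0 where "k0 = \<lceil>\<phi> a\<rceil>"
  have k0: "\<phi> a \<le> of_int k0" "of_int k0 < \<phi> a + 1" unfolding k0_def by linarith+
  have "\<exists>x. a \<le> x \<and> x < b \<and> \<phi> x = of_int k0 + real k - 1" if k: "k \<in> {1..m}" for k
  proof -
    have "real k \<ge> 1" "real k \<le> real m" using k by auto
    then have *: "\<phi> a \<le> of_int k0 + real k - 1" "of_int k0 + real k - 1 < \<phi> b"
      using k0 m by auto
    then obtain x where x: "a \<le> x" "x \<le> b" "\<phi> x = of_int k0 + real k - 1"
      using IVT'[of \<phi> a "of_int k0 + real k - 1" b] \<open>a \<le> b\<close> cont by auto
    moreover have "x \<noteq> b" using x * by auto
    ultimately show ?thesis by force
  qed
  then have "\<forall>k\<in>{1..m}. \<exists>x. a \<le> x \<and> x < b \<and> \<phi> x = of_int k0 + real k - 1" by blast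
  then obtain t where "\<forall>k\<in>{1..m}. a \<le> t k \<and> t k < b \<and> \<phi> (t k) = of_int k0 + real k - 1"
    by (auto dest!: bchoice)
  then have t: "a \<le> t k" "t k < b" "\<phi> (t k) = of_int k0 + real k - 1" if "k \<in> {1..m}" for k
    using that by blast+
  have less: "x < y" if "\<phi> x < \<phi> y" "x \<in> {a..b}" "y \<in> {a..b}" for x y
    using that mono[of y x] by (cases x y rule: linorder_cases) auto
  have "strict_mono_on {1..m} t"
  proof (rule strict_mono_onI)
    fix i j assume "i \<in> {1..m}" "j \<in> {1..m}" "i < j"
    then have "\<phi> (t i) < \<phi> (t j)" "t i \<in> {a..b}" "t j \<in> {a..b}"
      using t[of i] t[of j] by auto
    then show "t i < t j" by (rule less)
  qed
  moreover have "t ` {1..m} = {x \<in> {a..<b}. \<phi> x \<in> \<int>}"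
  proof (intro equalityI subsetI)
    fix x assume "x \<in> t ` {1..m}"
    then show "x \<in> {x \<in> {a..<b}. \<phi> x \<in> \<int>}" using t by auto
  next
    fix x assume "x \<in> {x \<in> {a..<b}. \<phi> x \<in> \<int>}"
    then obtain j where x: "a \<le> x" "x < b" and j: "\<phi> x = of_int j" by (auto elim: Ints_cases)
    have "\<phi> a \<le> \<phi> x" using mono[of a x] x by (cases "a = x") auto
    moreover have "\<phi> x < \<phi> b" using mono x by auto
    ultimately have "of_int j < (of_int k0 + of_int (int m) :: real)" "(of_int k0 :: real) < of_int j + 1"
      using k0 m j by auto
    then have jb: "k0 \<le> j" "j < k0 + int m" by linarith+
    define k where "k = nat (j - k0 + 1)"
    have k: "k \<in> {1..m}" "real k = of_int j - of_int k0 + 1" using jb by (auto simp: k_def)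
    then have "\<phi> (t k) = \<phi> x" using t j by auto
    then have "t k = x"
      using t(1,2)[OF k(1)] x mono[of "t k" x] mono[of x "t k"]
      by (cases "t k" x rule: linorder_cases) auto
    then show "x \<in> t ` {1..m}" using k by auto
  qed
  ultimately show ?thesis using that by blast
qed

lemma cis_eq_cis_iff: "cis x = cis y \<longleftrightarrow> (x - y) / (2 * pi) \<in> \<int>"
proof -
  have "cis x = cis y \<longleftrightarrow> (\<exists>k::int. x = y + 2 * pi * of_int k)"
    using sin_cos_eq_iff[of x y] by (auto simp: complex_eq_iff)
  also have "\<dots> \<longleftrightarrow> (\<exists>k::int. (x - y) / (2 * pi) = of_int k)"
    by (simp add: divide_eq_eq algebra_simps)
  finally show ?thesis by (auto simp: Ints_def)
qed

text \<open>In the frame rotated by \<open>cis (\<Psi> t)\<close>, the velocity of \<open>f (cis t)\<close> has radial part \<open>R'\<close> and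
  tangential part \<open>R \<Psi>'\<close>; its modulus is that of \<open>f'\<close>, since \<open>cis\<close> moves with unit speed.\<close>
lemma phase_derivative_bound:
  fixes \<Psi> R :: "real \<Rightarrow> real"
  assumes "R differentiable (at t)" "\<Psi> differentiable (at t)"
    and polar: "\<And>t. f (cis t) = of_real (R t) * cis (\<Psi> t)"
    and f: "(f has_field_derivative f') (at (cis t))"
  shows "\<bar>R t * deriv \<Psi> t\<bar> \<le> cmod f'"
proof -
  have dR: "(R has_vector_derivative deriv R t) (at t)"
    and dP: "(\<Psi> has_vector_derivative deriv \<Psi> t) (at t)"
    using assms(1,2) by (auto simp: DERIV_deriv_iff_real_differentiable[symmetric]
        has_real_derivative_iff_has_vector_derivative)
  have dcis: "((\<lambda>s. cis (h s)) has_vector_derivative (\<i> * of_real h' * cis (h t))) (at t)"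
    if "(h has_vector_derivative h') (at t)" for h h'
  proof -
    have "((\<lambda>s. \<i> * of_real (h s)) has_vector_derivative \<i> * of_real h') (at t)"
      using that by (intro has_vector_derivative_mult_right has_vector_derivative_of_real)
        (simp add: has_real_derivative_iff_has_vector_derivative)
    from field_vector_diff_chain_at[OF this, of exp "exp (\<i> * of_real (h t))"]
    show ?thesis by (simp add: o_def cis_conv_exp)
  qed
  have "((\<lambda>s. f (cis s)) has_vector_derivative \<i> * cis t * f') (at t)"
    using field_vector_diff_chain_at[OF dcis[OF has_vector_derivative_id] f] by (simp add: o_def)
  moreover have "((\<lambda>s. of_real (R s) * cis (\<Psi> s)) has_vector_derivative
      (of_real (R t) * (\<i> * of_real (deriv \<Psi> t) * cis (\<Psi> t)) + of_real (deriv R t) * cis (\<Psi> t))) (at t)"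
    using dR by (intro has_vector_derivative_mult dcis dP has_vector_derivative_of_real)
      (simp add: has_real_derivative_iff_has_vector_derivative)
  ultimately have "\<i> * cis t * f'
      = of_real (R t) * (\<i> * of_real (deriv \<Psi> t) * cis (\<Psi> t)) + of_real (deriv R t) * cis (\<Psi> t)"
    unfolding polar by (rule vector_derivative_unique_at)
  also have "\<dots> = Complex (deriv R t) (R t * deriv \<Psi> t) * cis (\<Psi> t)"
    by (simp add: Complex_eq algebra_simps)
  finally have "cmod (\<i> * cis t * f') = cmod (Complex (deriv R t) (R t * deriv \<Psi> t) * cis (\<Psi> t))"
    by simp
  then have "cmod f' = cmod (Complex (deriv R t) (R t * deriv \<Psi> t))" by (simp add: norm_mult)
  then show ?thesis using abs_Im_le_cmod[of "Complex (deriv R t) (R t * deriv \<Psi> t)"] by simp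
qed

section \<open>Separation of roots of unity\<close>

lemma cube_lower_bound_sin:
  fixes x :: real
  assumes "x \<ge> 0"
  shows "sin x \<ge> x - x ^ 3 / 6"
proof -
  have "sin 0 - 0 + 0 ^ 3 / 6 \<le> sin x - x + x ^ 3 / 6"
  proof (rule DERIV_nonneg_imp_nondecreasing[OF assms])
    fix u :: real assume "0 \<le> u"
    have "cos u = 1 - 2 * (sin (u / 2))\<^sup>2" using cos_double_sin[of "u / 2"] by simp
    moreover have "(sin (u / 2))\<^sup>2 \<le> (u / 2)\<^sup>2"
      using abs_sin_x_le_abs_x[of "u / 2"] by (metis abs_le_square_iff)
    ultimately have "0 \<le> cos u - 1 + u\<^sup>2 / 2" by (simp add: power_divide)
    moreover have "((\<lambda>x. sin x - x + x ^ 3 / 6) has_real_derivative cos u - 1 + u\<^sup>2 / 2) (at u)"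
      by (auto intro!: derivative_eq_intros)
    ultimately show "\<exists>y. ((\<lambda>x. sin x - x + x ^ 3 / 6) has_real_derivative y) (at u) \<and> 0 \<le> y"
      by blast
  qed
  then show ?thesis by simp
qed

text \<open>The constant \<open>4 / 3\<close> is chosen for its use below: distinct numbers of modulus at least \<open>3 / 4\<close> with
  the same \<open>2n\<close>-th power are then more than \<open>2 / n\<close> apart, and so do not fit into a disc of radius \<open>1 / n\<close>.\<close>
lemma sin_half_turn_fraction:
  assumes "n \<ge> (2::nat)"
  shows "sin (pi / (2 * real n)) > 4 / (3 * real n)"
proof -
  define x where "x = pi / (2 * real n)"
  have "pi < 32 / 10" using pi_approx by simp
  then have "pi * 5 < 8 * real n" using assms by linarith
  then have x: "0 < x" "x \<le> 4 / 5" using assms by (auto simp: x_def field_simps)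
  then have "x\<^sup>2 \<le> (4 / 5)\<^sup>2" by (intro power_mono) auto
  then have "x * (1 - 16 / 150) \<le> x * (1 - x\<^sup>2 / 6)"
    using x by (intro mult_left_mono) (auto simp: power2_eq_square)
  also have "\<dots> = x - x ^ 3 / 6" by (simp add: power3_eq_cube power2_eq_square algebra_simps)
  also have "\<dots> \<le> sin x" using x by (intro cube_lower_bound_sin) auto
  finally have "x * (134 / 150) \<le> sin x" by simp
  moreover have "pi > 3" using pi_approx by simp
  then have "4 / (3 * real n) < x * (134 / 150)" using assms by (simp add: x_def field_simps)
  ultimately show ?thesis by (simp add: x_def)
qed

text \<open>The quotient is a nontrivial root of unity, and the nearest such root to \<open>1\<close> is one step of
  angle \<open>2 \<pi> / m\<close> away; its chord is \<open>2 sin (\<pi> / m)\<close>.\<close>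
lemma power_eq_imp_norm_diff_ge:
  fixes z w :: complex
  assumes eq: "z ^ m = w ^ m" and "z \<noteq> w" and "m \<ge> 1"
  shows "cmod (z - w) \<ge> 2 * cmod w * sin (pi / real m)"
proof (cases "w = 0")
  case False
  have "(z / w) ^ m = 1" using eq False by (simp add: power_divide)
  then obtain j where j: "z / w = exp (2 * of_real pi * \<i> * of_nat j / of_nat m)" "j < m"
    using complex_roots_unity[OF \<open>m \<ge> 1\<close>] by auto
  have j0: "j \<noteq> 0" using j False \<open>z \<noteq> w\<close> by (cases "j = 0") auto
  have "z / w = exp (\<i> * of_real (2 * (pi * real j / real m)))"
    by (simp add: j mult_ac)
  then have n: "cmod (z / w - 1) = 2 * \<bar>sin (pi * real j / real m)\<bar>"
    by (simp only: dist_exp_i_1) simp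
  have mono: "sin (pi / real m) \<le> sin (pi * real k / real m)" if "1 \<le> k" "2 * k \<le> m" for k
  proof (rule sin_monotone_2pi_le)
    have k: "1 \<le> real k" "real k * 2 \<le> real m" using that by linarith+
    have m: "real m > 0" using \<open>m \<ge> 1\<close> by simp
    have "0 \<le> pi / real m" by simp
    then show "- (pi / 2) \<le> pi / real m" using pi_gt_zero by linarith
    show "pi / real m \<le> pi * real k / real m"
      using m k pi_gt_zero by (intro divide_right_mono) auto
    have "pi * (real k * 2) \<le> pi * real m" using k by (intro mult_left_mono) auto
    then show "pi * real k / real m \<le> pi / 2" using m by (simp add: field_simps)
  qed
  have "sin (pi / real m) \<le> sin (pi * real j / real m)"
  proof (cases "2 * j \<le> m")
    case True
    then show ?thesis using j0 by (intro mono) auto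
  next
    case False
    have "sin (pi * real j / real m) = sin (pi - pi * real j / real m)" by simp
    also have "pi - pi * real j / real m = pi * real (m - j) / real m"
      using j(2) by (simp add: of_nat_diff right_diff_distrib diff_divide_distrib)
    finally show ?thesis using mono[of "m - j"] False j(2) by auto
  qed
  then have "2 * sin (pi / real m) \<le> cmod (z / w - 1)" using n by linarith
  also have "\<dots> = cmod (z - w) / cmod w"
    using False by (simp add: norm_divide[symmetric] diff_divide_distrib)
  finally show ?thesis using False by (simp add: field_simps)
qed auto

section \<open>A contraction principle for power equations\<close>

text \<open>On the disc around \<open>u\<close> the function \<open>f\<close> has a holomorphic \<open>m\<close>-th root \<open>F\<close>, which can be normalised
  by \<open>F u = \<zeta>\<close>. Since \<open>m * F' * F ^ (m - 1) = f'\<close>, the bound on \<open>f'\<close> says that \<open>\<bar>F'\<bar> \<le> K\<close>. Hence \<open>F\<close> is a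
  contraction, and by the condition on \<open>K * (cmod (\<zeta> - u) + r)\<close> it maps the disc around \<open>\<zeta>\<close> into
  itself; the Banach fixed point is a solution. Any other solution \<open>z\<close> would satisfy \<open>F z \<noteq> z\<close> with
  \<open>F z ^ m = z ^ m\<close>, and such points are too far apart to lie in a common disc of radius \<open>r\<close>.\<close>
lemma unique_solution_power_eq:
  fixes f f' :: "complex \<Rightarrow> complex" and u \<zeta> :: complex and m :: nat and r K \<sigma> \<rho> :: real
  assumes m: "m \<ge> 2" and r: "r > 0" and K: "0 \<le> K" "K < 1"
    and deriv: "\<And>z. z \<in> ball u \<rho> \<Longrightarrow> (f has_field_derivative f' z) (at z)"
    and nz: "\<And>z. z \<in> ball u \<rho> \<Longrightarrow> f z \<noteq> 0"
    and bound: "\<And>z. z \<in> ball u \<rho> \<Longrightarrow> cmod (f' z) \<le> real m * K * cmod (f z) powr (1 - 1 / real m)"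
    and \<zeta>: "\<zeta> ^ m = f u"
    and self: "K * (cmod (\<zeta> - u) + r) \<le> r"
    and sub: "cmod (\<zeta> - u) + r < \<rho>"
    and \<sigma>: "\<sigma> \<ge> 0" "\<And>z. z \<in> cball \<zeta> r \<Longrightarrow> \<sigma> ^ m \<le> cmod (f z)"
    and sep: "r < \<sigma> * sin (pi / real m)"
  shows "\<exists>!z. z \<in> cball \<zeta> r \<and> z ^ m = f z"
proof -
  define S where "S = ball u \<rho>"
  have uS: "u \<in> S" using sub r unfolding S_def
    by (metis add_nonneg_pos centre_in_ball norm_ge_zero order_le_less_trans less_imp_le order_less_le_trans)
  have BS: "cball \<zeta> r \<subseteq> S"
  proof
    fix z assume "z \<in> cball \<zeta> r"
    then have "dist u z \<le> cmod (\<zeta> - u) + r"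
      using dist_triangle[of u z \<zeta>] by (simp add: dist_norm norm_minus_commute)
    then show "z \<in> S" using sub by (simp add: S_def)
  qed
  have "f holomorphic_on S"
    using deriv unfolding S_def by (intro holomorphic_onI) (auto simp: field_differentiable_def intro: DERIV_subset)
  then obtain h where h: "h holomorphic_on S" "\<And>z. z \<in> S \<Longrightarrow> f z = exp (h z)"
    using contractible_imp_holomorphic_log[of f S] nz
    by (auto simp: S_def convex_imp_contractible)
  define F where "F z = \<zeta> * exp ((h z - h u) / of_nat m)" for z
  have Fm: "F z ^ m = f z" if "z \<in> S" for z
  proof -
    have "exp ((h z - h u) / of_nat m) ^ m = exp (h z - h u)"
      using m by (simp flip: exp_of_nat_mult)
    then show ?thesis
      using h(2)[OF that] h(2)[OF uS] by (simp add: F_def power_mult_distrib \<zeta> exp_diff)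
  qed
  have Fu: "F u = \<zeta>" by (simp add: F_def)
  have hF: "F holomorphic_on S"
    unfolding F_def using h(1) m by (intro holomorphic_intros) auto
  have dF: "(F has_field_derivative deriv F z) (at z)" if "z \<in> S" for z
    using hF that unfolding S_def by (rule holomorphic_derivI[OF _ open_ball])
  have Fn: "cmod (F z) = cmod (f z) powr (1 / real m)" if "z \<in> S" for z
  proof -
    have "cmod (F z) ^ m = cmod (f z)" using Fm[OF that] by (metis norm_power)
    then have "cmod (f z) powr (1 / real m) = (cmod (F z) powr real m) powr (1 / real m)"
      using nz that m Fm[OF that] by (subst powr_realpow) (auto simp: S_def power_0_left)
    then show ?thesis using m by (simp add: powr_powr)
  qed
  have F'bound: "cmod (deriv F z) \<le> K" if z: "z \<in> S" for z
  proof -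
    have "((\<lambda>z. F z ^ m) has_field_derivative of_nat m * (deriv F z * F z ^ (m - 1))) (at z)"
      using DERIV_power[OF dF[OF z], of m] by (simp add: mult_ac)
    moreover have "(f has_field_derivative f' z) (at z)" using deriv z by (simp add: S_def)
    then have "((\<lambda>z. F z ^ m) has_field_derivative f' z) (at z)"
      by (rule has_field_derivative_transform_within_open[where S = S])
         (use Fm z in \<open>auto simp: S_def\<close>)
    ultimately have "f' z = of_nat m * (deriv F z * F z ^ (m - 1))"
      by (metis DERIV_unique)
    then have "cmod (f' z) = real m * (cmod (deriv F z) * cmod (F z) ^ (m - 1))"
      by (simp add: norm_mult norm_power)
    moreover have pos: "cmod (f z) > 0" using nz z by (simp add: S_def)
    have "cmod (F z) ^ (m - 1) = cmod (F z) powr real (m - 1)"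
      using pos by (subst powr_realpow) (auto simp: Fn[OF z])
    then have "cmod (F z) ^ (m - 1) = cmod (f z) powr (1 - 1 / real m)"
      using m by (simp add: Fn[OF z] powr_powr of_nat_diff diff_divide_distrib)
    moreover have "cmod (f' z) \<le> real m * K * cmod (f z) powr (1 - 1 / real m)"
      using bound z by (simp add: S_def)
    ultimately have "real m * (cmod (deriv F z) * cmod (f z) powr (1 - 1 / real m))
        \<le> real m * (K * cmod (f z) powr (1 - 1 / real m))" by simp
    then show ?thesis using pos m by simp
  qed
  have lip: "cmod (F x - F y) \<le> K * cmod (x - y)" if "x \<in> S" "y \<in> S" for x y
    by (rule field_differentiable_bound[of S F "deriv F"])
       (use that dF F'bound in \<open>auto simp: S_def intro: DERIV_subset\<close>)
  have FB: "F z \<in> cball \<zeta> r" if z: "z \<in> cball \<zeta> r" for z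
  proof -
    have "cmod (F z - \<zeta>) \<le> K * cmod (z - u)" using lip[of z u] Fu BS z uS by auto
    also have "cmod (z - u) \<le> cmod (\<zeta> - u) + r"
      using z norm_triangle_ineq[of "z - \<zeta>" "\<zeta> - u"] by (simp add: dist_norm norm_minus_commute)
    finally have "cmod (F z - \<zeta>) \<le> K * (cmod (\<zeta> - u) + r)" using K by (simp add: mult_left_mono)
    then show ?thesis using self by (simp add: dist_norm norm_minus_commute)
  qed
  have root_iff: "z ^ m = f z \<longleftrightarrow> F z = z" if z: "z \<in> cball \<zeta> r" for z
  proof
    assume "F z = z" then show "z ^ m = f z" using Fm z BS by (metis subsetD)
  next
    assume eq: "z ^ m = f z"
    show "F z = z"
    proof (rule ccontr)
      assume "F z \<noteq> z"
      then have "2 * cmod z * sin (pi / real m) \<le> cmod (F z - z)"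
        using eq Fm z BS m by (intro power_eq_imp_norm_diff_ge) auto
      also have "\<dots> \<le> 2 * r"
        using z FB[OF z] dist_triangle[of "F z" z \<zeta>] by (simp add: dist_norm norm_minus_commute)
      finally have "cmod z * sin (pi / real m) \<le> r" by simp
      moreover have "\<sigma> ^ m \<le> cmod z ^ m" using \<sigma>(2)[OF z] eq by (metis norm_power)
      then have "\<sigma> \<le> cmod z" using m by (simp add: power_mono_iff \<sigma>)
      moreover have "sin (pi / real m) \<ge> 0"
        using m by (intro sin_ge_zero) (auto simp: field_simps)
      ultimately show False using sep mult_right_mono by (metis not_le order_trans)
    qed
  qed
  have "dist (F x) (F y) \<le> K * dist x y" if "x \<in> cball \<zeta> r" "y \<in> cball \<zeta> r" for x y
    unfolding dist_norm using that BS by (intro lip) auto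
  moreover have "F ` cball \<zeta> r \<subseteq> cball \<zeta> r" using FB by blast
  moreover have "complete (cball \<zeta> r)" "cball \<zeta> r \<noteq> {}" using r by (auto simp: complete_eq_closed)
  ultimately have "\<exists>!z\<in>cball \<zeta> r. F z = z"
    using Banach_fix[of "cball \<zeta> r" K F] K by blast
  then show ?thesis using root_iff by metis
qed

section \<open>The reflection symmetry of g\<close>

text \<open>Reversal of coefficients swaps \<open>p\<close> and \<open>p_rev\<close>, so inversion of the argument inverts the value.\<close>
lemma g_inverse: "z \<noteq> 0 \<Longrightarrow> g b0 b1 cm1 c0 (inverse z) = inverse (g b0 b1 cm1 c0 z)"
proof -
  assume z: "z \<noteq> 0"
  then have "poly (p b0 b1 cm1 c0) (inverse z) = poly (p_rev b0 b1 cm1 c0) z / z ^ 4"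
    by (simp add: poly_p_rev_eq)
  moreover have "poly (p_rev b0 b1 cm1 c0) (inverse z) = poly (p b0 b1 cm1 c0) z / z ^ 4"
    using z by (simp add: poly_p_rev_eq power_inverse field_simps)
  ultimately show ?thesis using z by (simp add: g_def)
qed

lemma g_has_deriv:
  assumes "g b0 b1 cm1 c0 z \<noteq> 0"
  shows "(g b0 b1 cm1 c0 has_field_derivative deriv (g b0 b1 cm1 c0) z) (at z)"
proof -
  have "poly (p_rev b0 b1 cm1 c0) z \<noteq> 0" using assms by (auto simp: g_def)
  then have "(\<lambda>z. poly (p b0 b1 cm1 c0) z / poly (p_rev b0 b1 cm1 c0) z) field_differentiable at z"
    using poly_DERIV field_differentiable_def by (intro field_differentiable_divide) blast+
  then show ?thesis by (simp add: g_def[abs_def] field_differentiable_derivI)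
qed

text \<open>Where \<open>g\<close> is small, its derivative is far smaller than the derivative at the reflected point.
  A uniform bound on \<open>g'\<close> near the circle therefore forces \<open>g'\<close> to be small wherever \<open>g\<close> is, which
  is how a factor \<open>C\<close> is saved in the disc estimate.\<close>
lemma norm_deriv_g_inverse:
  assumes "z \<noteq> 0" "g b0 b1 cm1 c0 z \<noteq> 0"
  shows "cmod (deriv (g b0 b1 cm1 c0) z)
    = cmod (deriv (g b0 b1 cm1 c0) (inverse z)) * (cmod (g b0 b1 cm1 c0 z))\<^sup>2 / (cmod z)\<^sup>2"
proof -
  let ?g = "g b0 b1 cm1 c0"
  have nz: "?g (inverse z) \<noteq> 0" using assms by (simp add: g_inverse)
  have "(inverse has_field_derivative - (inverse z)\<^sup>2) (at z)"
    using DERIV_inverse[OF assms(1)] by (simp add: numeral_2_eq_2)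
  then have "((\<lambda>w. ?g (inverse w)) has_field_derivative deriv ?g (inverse z) * - (inverse z)\<^sup>2) (at z)"
    by (rule DERIV_chain2[where f = ?g and g = inverse, OF g_has_deriv[OF nz]])
  then have "((\<lambda>w. inverse (?g (inverse w))) has_field_derivative
      - (inverse (?g (inverse z)) * (deriv ?g (inverse z) * - (inverse z)\<^sup>2) * inverse (?g (inverse z)))) (at z)"
    using nz by (rule DERIV_inverse')
  then have "(?g has_field_derivative
      - (inverse (?g (inverse z)) * (deriv ?g (inverse z) * - (inverse z)\<^sup>2) * inverse (?g (inverse z)))) (at z)"
    by (rule has_field_derivative_transform_within_open[where S = "- {0}"])
       (use assms g_inverse in auto)
  then have "deriv ?g z = ?g z * (deriv ?g (inverse z) * (inverse z)\<^sup>2) * ?g z"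
    using assms by (simp add: DERIV_imp_deriv g_inverse)
  then show ?thesis
    by (simp add: norm_mult norm_power norm_inverse power2_eq_square divide_inverse mult_ac)
qed

section \<open>The root in a single disc\<close>

text \<open>A bound of the form \<open>M * min 1 \<bar>g\<bar>\<close> on \<open>\<bar>g'\<bar>\<close> becomes a bound \<open>M / m\<close> on the derivative of an
  \<open>m\<close>-th root of \<open>g\<close>.\<close>
lemma le_powr_one_minus:
  fixes x :: real
  assumes "0 < x" "m \<ge> (1::nat)"
  shows "min 1 x \<le> x powr (1 - 1 / real m)"
proof (cases "x \<ge> 1")
  case True
  then show ?thesis using assms by (simp add: ge_one_powr_ge_zero)
next
  case False
  then have "x powr 1 \<le> x powr (1 - 1 / real m)"
    using assms by (intro powr_mono') auto
  then show ?thesis using False assms by simp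
qed

text \<open>Bernoulli's inequality applied to the root and to its inverse.\<close>
lemma root_near_one:
  fixes x C :: real
  assumes "inverse C < x" "x < C" "C > 1" "m \<ge> (1::nat)"
  shows "\<bar>x powr (1 / real m) - 1\<bar> \<le> (C - 1) / real m"
proof -
  define s where "s = x powr (1 / real m)"
  have x: "x > 0" using assms by (meson inverse_positive_iff_positive less_trans zero_less_one)
  then have s: "s > 0" and sm: "s ^ m = x"
    using assms by (auto simp: s_def powr_realpow[symmetric] powr_powr)
  have bern: "real m * (y - 1) \<le> y ^ m - 1" if "y \<ge> 0" for y :: real
    using Bernoulli_inequality[of "y - 1" m] that by simp
  have "real m * (s - 1) \<le> C - 1" using bern[of s] s sm assms by simp
  then have 1: "s - 1 \<le> (C - 1) / real m" using assms by (simp add: field_simps)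
  have "inverse x < C"
    using assms x by (metis inverse_less_iff_less inverse_inverse_eq
        inverse_positive_iff_positive less_trans zero_less_one)
  then have "real m * (inverse s - 1) \<le> C - 1"
    using bern[of "inverse s"] s sm by (simp add: power_inverse)
  then have "inverse s - 1 \<le> (C - 1) / real m" using assms by (simp add: field_simps)
  moreover have "s + inverse s \<ge> 2"
  proof -
    have "0 \<le> (s - 1)\<^sup>2 / s" using s by simp
    also have "\<dots> = s + inverse s - 2" using s by (simp add: power2_eq_square field_simps)
    finally show ?thesis by simp
  qed
  ultimately show ?thesis using 1 unfolding s_def by linarith
qed

text \<open>Here \<open>K\<close> bounds the derivative of a \<open>2n\<close>-th root of \<open>g\<close> and \<open>x\<close> is the largest distance of a point of the
  disc from \<open>cis t\<close>. For \<open>K = C D / (2 n)\<close> the condition on \<open>K\<close> reads \<open>(C + 1) (1 - \<Delta>) \<le> 2\<close>; for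
  \<open>K = D (1 + \<Delta>) / (2 n)\<close> it reads \<open>(C + 1) (1 - \<Delta>\<^sup>2) \<le> 2 C\<close>, which holds for all \<open>C \<ge> 1\<close>.\<close>
lemma bootstrap_bound_radius:
  fixes C D \<Delta> n x :: real
  assumes "n > 0" "C > 1" "D > 0" "0 < \<Delta>" "\<Delta> < 1"
    and x: "x \<le> (C + 1) / (2 * n)"
    and K: "K * (C + 1) * n * (1 - \<Delta>) \<le> C * D" "K \<ge> 0"
  shows "K * x \<le> C * D / (2 * (1 - \<Delta>) * n\<^sup>2)"
proof -
  have "K * x \<le> K * ((C + 1) / (2 * n))" using x K by (intro mult_left_mono)
  also have "\<dots> = K * (C + 1) * n * (1 - \<Delta>) / (2 * (1 - \<Delta>) * n\<^sup>2)"
  proof -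
    have "1 - \<Delta> > 0" using assms by simp
    then show ?thesis using \<open>n > 0\<close> by (simp only: power2_eq_square) (simp add: divide_simps)
  qed
  also have "\<dots> \<le> C * D / (2 * (1 - \<Delta>) * n\<^sup>2)"
    using K assms by (intro divide_right_mono) auto
  finally show ?thesis .
qed

text \<open>The contraction principle is applied with \<open>f = g\<close>, \<open>u = cis t\<close> and \<open>\<zeta>\<close> the centre of the disc.
  All points of the disc lie within \<open>(C + 1) / (2 n)\<close> of \<open>u\<close>. With the derivative bound \<open>K = C D / (2 n)\<close>
  that holds throughout the annulus, the estimate shows that the disc is mapped into itself if
  \<open>C \<le> (1 + \<Delta>) / (1 - \<Delta>)\<close>. For larger \<open>C\<close> the hypothesis \<open>n > C / \<Delta>\<close> makes \<open>(C + 1) / (2 n)\<close> at most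
  \<open>\<Delta> / (1 + \<Delta>)\<close>, and for \<open>z\<close> closer than that to the unit circle \<open>1 / z\<close> lies in the annulus as
  well. The reflection symmetry then improves the derivative bound to \<open>K = D (1 + \<Delta>) / (2 n)\<close>, which is
  free of \<open>C\<close>.\<close>
lemma unique_root_in_disc:
  fixes b0 b1 cm1 c0 :: complex and n :: nat and \<Delta> C D t :: real
  assumes \<Delta>: "0 < \<Delta>" "\<Delta> < 1" and C: "C > 1" and D: "D > 0"
    and gC: "\<And>z. z \<in> annulus \<Delta> \<Longrightarrow>
           inverse C < cmod (g b0 b1 cm1 c0 z) \<and> cmod (g b0 b1 cm1 c0 z) < C"
    and gD: "\<And>z. z \<in> annulus \<Delta> \<Longrightarrow> cmod (deriv (g b0 b1 cm1 c0) z) < D"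
    and n: "real n > C * D / (2 * (1 - \<Delta>))" "real n > C / \<Delta>"
    and phase: "g b0 b1 cm1 c0 (cis t) = of_real (cmod (g b0 b1 cm1 c0 (cis t))) * cis (2 * real n * t)"
  shows "\<exists>!z. z \<in> cball (z_star b0 b1 cm1 c0 n t) (C * D / (2 * (1 - \<Delta>) * real n ^ 2))
               \<and> H b0 b1 cm1 c0 n z = 0"
proof -
  let ?g = "g b0 b1 cm1 c0"
  define u where "u = cis t"
  define \<zeta> where "\<zeta> = z_star b0 b1 cm1 c0 n t"
  define r where "r = C * D / (2 * (1 - \<Delta>) * real n ^ 2)"
  have Cn: "C < \<Delta> * real n" using n(2) \<Delta> by (simp add: field_simps)
  also have "\<Delta> * real n \<le> 1 * real n" using \<Delta> by (intro mult_right_mono) auto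
  finally have Cn1: "C < real n" by simp
  then have n2: "n \<ge> 2" using C by linarith
  have npos: "real n > 0" using n2 by simp
  have CDn: "C * D < 2 * (1 - \<Delta>) * real n" using n(1) \<Delta> by (simp add: field_simps)
  have r: "r > 0" "r < 1 / real n"
  proof -
    show "r > 0" using \<Delta> C D npos by (simp add: r_def)
    have "r = C * D / (2 * (1 - \<Delta>) * real n) / real n"
      by (simp add: r_def power2_eq_square)
    also have "\<dots> < 1 / real n"
      using CDn \<Delta> npos by (intro divide_strict_right_mono) auto
    finally show "r < 1 / real n" .
  qed
  have u_ann: "z \<in> annulus \<Delta>" if "z \<in> ball u \<Delta>" for z
  proof -
    have "\<bar>cmod z - cmod u\<bar> \<le> cmod (z - u)" by (rule norm_triangle_ineq3)
    also have "\<dots> < \<Delta>" using that by (simp add: dist_norm norm_minus_commute)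
    finally have "\<bar>cmod z - 1\<bar> < \<Delta>" by (simp add: u_def)
    then show ?thesis unfolding annulus_def by (simp add: abs_less_iff)
  qed
  have gpos: "cmod (?g z) > 0" if "z \<in> annulus \<Delta>" for z
  proof -
    have "inverse C > 0" using C by simp
    then show ?thesis using gC[OF that] by linarith
  qed
  have uA: "u \<in> annulus \<Delta>" using \<Delta> by (intro u_ann) simp
  define R where "R = cmod (?g u)"
  have R: "inverse C < R" "R < C" "R > 0" using gC[OF uA] gpos[OF uA] by (auto simp: R_def)
  have \<zeta>_eq: "\<zeta> = of_real (R powr (1 / real (2 * n))) * u"
    by (simp add: \<zeta>_def z_star_def R_def u_def)
  have "\<zeta> - u = of_real (R powr (1 / real (2 * n)) - 1) * u"
    by (simp add: \<zeta>_eq algebra_simps)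
  then have "cmod (\<zeta> - u) = \<bar>R powr (1 / real (2 * n)) - 1\<bar>"
    by (simp only: norm_mult norm_of_real) (simp add: u_def)
  also have "\<dots> \<le> (C - 1) / real (2 * n)"
    using R C n2 by (intro root_near_one) auto
  finally have \<zeta>u: "cmod (\<zeta> - u) \<le> (C - 1) / (2 * real n)" by simp
  have reach: "cmod (\<zeta> - u) + r < (C + 1) / (2 * real n)"
  proof -
    have "(C - 1) / (2 * real n) + 1 / real n = (C + 1) / (2 * real n)"
      using npos by (simp add: field_simps)
    then show ?thesis using \<zeta>u r by linarith
  qed
  have \<zeta>_pow: "\<zeta> ^ (2 * n) = ?g u"
  proof -
    have "(R powr (1 / real (2 * n))) ^ (2 * n) = R"
      using R n2 by (simp add: powr_realpow[symmetric] powr_powr)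
    moreover have "u ^ (2 * n) = cis (2 * real n * t)"
      by (simp only: u_def Complex.DeMoivre of_nat_mult of_nat_numeral)
    ultimately show ?thesis using phase
      by (simp only: \<zeta>_eq power_mult_distrib of_real_power[symmetric] u_def R_def)
  qed
  \<comment> \<open>The two cases differ only in the derivative bound and in the disc on which it holds.\<close>
  have key: "\<exists>!z. z \<in> cball \<zeta> r \<and> z ^ (2 * n) = ?g z"
    if K: "0 \<le> K" "K < 1" "K * (C + 1) * real n * (1 - \<Delta>) \<le> C * D"
      and \<rho>: "(C + 1) / (2 * real n) \<le> \<rho>" "\<rho> \<le> \<Delta>"
      and bound: "\<And>z. z \<in> ball u \<rho> \<Longrightarrow>
        cmod (deriv ?g z) \<le> real (2 * n) * K * cmod (?g z) powr (1 - 1 / real (2 * n))"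
    for K \<rho>
  proof (rule unique_solution_power_eq[where f = ?g and f' = "deriv ?g" and u = u and \<rho> = \<rho>
        and \<sigma> = "3 / 4", OF _ r(1) K(1,2) _ _ bound \<zeta>_pow])
    show "2 \<le> 2 * n" using n2 by simp
    have A: "z \<in> annulus \<Delta>" if "z \<in> ball u \<rho>" for z
      using that \<rho> by (intro u_ann) auto
    show nz: "?g z \<noteq> 0" if "z \<in> ball u \<rho>" for z
      using gpos[OF A[OF that]] by simp
    show "(?g has_field_derivative deriv ?g z) (at z)" if "z \<in> ball u \<rho>" for z
      by (rule g_has_deriv[OF nz[OF that]])
    show "K * (cmod (\<zeta> - u) + r) \<le> r"
      unfolding r_def
      by (rule bootstrap_bound_radius) (use npos C D \<Delta> K reach in \<open>auto simp: r_def less_imp_le\<close>)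
    show "cmod (\<zeta> - u) + r < \<rho>" using reach \<rho> by linarith
    \<comment> \<open>Since \<open>C < n \<le> (1 + n / 3)\<^sup>2 \<le> (4 / 3) ^ (2 * n)\<close>, every root in the disc has modulus at least \<open>3 / 4\<close>.\<close>
    show "(3 / 4) ^ (2 * n) \<le> cmod (?g z)" if "z \<in> cball \<zeta> r" for z
    proof -
      have "dist u z \<le> cmod (\<zeta> - u) + r"
        using dist_triangle[of u z \<zeta>] that by (simp add: dist_norm norm_minus_commute)
      then have "z \<in> annulus \<Delta>" using reach \<rho> by (intro A) auto
      then have "inverse C < cmod (?g z)" using gC by blast
      moreover have "(3 / 4 :: real) ^ (2 * n) \<le> inverse C"
      proof -
        have "1 + real n * (1 / 3) \<le> (1 + 1 / 3) ^ n" by (rule Bernoulli_inequality) simp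
        then have "(1 + real n / 3)\<^sup>2 \<le> ((4 / 3) ^ n)\<^sup>2" by (intro power_mono) auto
        moreover have "C \<le> (1 + real n / 3)\<^sup>2"
        proof -
          have "(1 + real n / 3)\<^sup>2 - real n = (1 - real n / 3)\<^sup>2 + real n / 3"
            by (simp add: power2_eq_square field_simps)
          moreover have "(1 - real n / 3)\<^sup>2 + real n / 3 \<ge> 0" by simp
          ultimately show ?thesis using Cn1 by linarith
        qed
        ultimately have "C \<le> (4 / 3) ^ (2 * n)" by (simp add: power_mult[symmetric] mult.commute)
        then have "inverse ((4 / 3) ^ (2 * n)) \<le> inverse C" using C by (intro le_imp_inverse_le) auto
        then show ?thesis by (simp add: power_inverse[symmetric])
      qed
      ultimately show ?thesis by linarith
    qed
    have "4 / (3 * real n) < sin (pi / (2 * real n))" by (rule sin_half_turn_fraction[OF n2])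
    then have "1 / real n < 3 / 4 * sin (pi / real (2 * n))" using npos by (simp add: field_simps)
    then show "r < 3 / 4 * sin (pi / real (2 * n))" using r by linarith
  qed auto
  have "\<exists>!z. z \<in> cball \<zeta> r \<and> z ^ (2 * n) = ?g z"
  proof (cases "1 + \<Delta> \<le> C * (1 - \<Delta>)")
    case False
    show ?thesis
    proof (rule key[of "C * D / (2 * real n)" \<Delta>])
      show "0 \<le> C * D / (2 * real n)" using C D by simp
      have "C * D < 2 * real n"
      proof -
        have "(1 - \<Delta>) * real n \<le> 1 * real n" using \<Delta> by (intro mult_right_mono) auto
        then show ?thesis using CDn by linarith
      qed
      then show "C * D / (2 * real n) < 1" using npos by simp
      have "(C + 1) * (1 - \<Delta>) \<le> 2" using False by (simp add: algebra_simps)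
      then have "C * D * ((C + 1) * (1 - \<Delta>)) \<le> C * D * 2" using C D by (intro mult_left_mono) auto
      then show "C * D / (2 * real n) * (C + 1) * real n * (1 - \<Delta>) \<le> C * D"
        using npos by (simp add: mult_ac)
      show "(C + 1) / (2 * real n) \<le> \<Delta>"
        using Cn C npos by (simp add: field_simps)
      fix z assume "z \<in> ball u \<Delta>"
      then have z: "z \<in> annulus \<Delta>" by (rule u_ann)
      let ?P = "cmod (?g z) powr (1 - 1 / real (2 * n))"
      \<comment> \<open>The lower bound on \<open>\<bar>g\<bar>\<close> absorbs the exponent, at the price of a factor \<open>C\<close>.\<close>
      have "inverse C \<le> min 1 (cmod (?g z))" using gC[OF z] C by (auto simp: field_simps)
      also have "\<dots> \<le> ?P" using gpos[OF z] n2 by (intro le_powr_one_minus) auto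
      finally have "C * D * inverse C \<le> C * D * ?P" using C D by (intro mult_left_mono) auto
      moreover have "C * D * inverse C = D" using C by simp
      ultimately have "D \<le> C * D * ?P" by (simp only:)
      then show "cmod (deriv ?g z) \<le> real (2 * n) * (C * D / (2 * real n)) * ?P"
        using gD[OF z] npos by simp
    qed simp
  next
    case True
    show ?thesis
    proof (rule key[of "D * (1 + \<Delta>) / (2 * real n)" "\<Delta> / (1 + \<Delta>)"])
      show "0 \<le> D * (1 + \<Delta>) / (2 * real n)" using D \<Delta> by simp
      have "D * (1 + \<Delta>) \<le> D * (C * (1 - \<Delta>))" using True D by (intro mult_left_mono) auto
      also have "\<dots> = (C * D) * (1 - \<Delta>)" by simp
      also have "\<dots> \<le> (C * D) * 1" using C D \<Delta> by (intro mult_left_mono) auto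
      also have "\<dots> < 2 * real n"
      proof -
        have "(1 - \<Delta>) * real n \<le> 1 * real n" using \<Delta> by (intro mult_right_mono) auto
        then show ?thesis using CDn by linarith
      qed
      finally show "D * (1 + \<Delta>) / (2 * real n) < 1" using npos by simp
      have "(1 - \<Delta>\<^sup>2) * (C + 1) \<le> 1 * (2 * C)"
        using C \<Delta> by (intro mult_mono) (auto simp: power_le_one)
      then have "D * ((1 + \<Delta>) * (C + 1) * (1 - \<Delta>)) \<le> D * (2 * C)"
        using D by (intro mult_left_mono) (auto simp: power2_eq_square algebra_simps)
      then show "D * (1 + \<Delta>) / (2 * real n) * (C + 1) * real n * (1 - \<Delta>) \<le> C * D"
        using npos by (simp add: mult_ac)
      have "(C + 1) * (1 + \<Delta>) \<le> 2 * C" using True by (simp add: algebra_simps)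
      also have "2 * C \<le> 2 * (\<Delta> * real n)" using Cn by simp
      finally show "(C + 1) / (2 * real n) \<le> \<Delta> / (1 + \<Delta>)"
        using npos \<Delta> by (simp add: divide_le_eq le_divide_eq mult_ac)
      show "\<Delta> / (1 + \<Delta>) \<le> \<Delta>" using \<Delta> by (simp add: divide_le_eq)
      fix z assume zb: "z \<in> ball u (\<Delta> / (1 + \<Delta>))"
      then have z: "z \<in> annulus \<Delta>"
        using \<open>\<Delta> / (1 + \<Delta>) \<le> \<Delta>\<close> by (intro u_ann) auto
      let ?x = "cmod (?g z)"
      let ?P = "?x powr (1 - 1 / real (2 * n))"
      have "\<bar>cmod z - cmod u\<bar> \<le> cmod (z - u)" by (rule norm_triangle_ineq3)
      then have "cmod z > 1 - \<Delta> / (1 + \<Delta>)"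
        using zb by (simp add: u_def dist_norm norm_minus_commute)
      also have "1 - \<Delta> / (1 + \<Delta>) = 1 / (1 + \<Delta>)" using \<Delta> by (simp add: field_simps)
      finally have zlow: "1 / (1 + \<Delta>) < cmod z" .
      then have z0: "cmod z > 0" using \<Delta> by (meson add_pos_pos divide_pos_pos less_trans zero_less_one)
      have zinv: "inverse (cmod z) < 1 + \<Delta>" using zlow z0 \<Delta> by (simp add: field_simps)
      have zup: "cmod z < 1 + \<Delta>" using z by (simp add: annulus_def)
      have "(1 - \<Delta>) * cmod z \<le> (1 - \<Delta>) * (1 + \<Delta>)" using zup \<Delta> by (intro mult_left_mono) auto
      also have "\<dots> = 1 - \<Delta> * \<Delta>" by (simp add: algebra_simps)
      also have "\<dots> < 1" using \<Delta> by simp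
      finally have "1 - \<Delta> < inverse (cmod z)" using z0 by (simp add: field_simps)
      then have "inverse z \<in> annulus \<Delta>" using zinv by (simp add: annulus_def norm_inverse)
      then have "cmod (deriv ?g (inverse z)) \<le> D" using gD less_imp_le by blast
      then have "cmod (deriv ?g (inverse z)) * ?x\<^sup>2 / (cmod z)\<^sup>2 \<le> D * ?x\<^sup>2 / (cmod z)\<^sup>2"
        by (intro divide_right_mono mult_right_mono) auto
      then have d2: "cmod (deriv ?g z) \<le> D * ?x\<^sup>2 / (cmod z)\<^sup>2"
        using norm_deriv_g_inverse[of z b0 b1 cm1 c0] z0 gpos[OF z] by simp
      have d1: "cmod (deriv ?g z) \<le> D" using gD[OF z] by simp
      \<comment> \<open>The geometric mean of the bounds at \<open>z\<close> and at \<open>1 / z\<close> is linear in \<open>\<bar>g\<bar>\<close>.\<close>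
      have "(cmod (deriv ?g z))\<^sup>2 \<le> D * (D * ?x\<^sup>2 / (cmod z)\<^sup>2)"
        unfolding power2_eq_square[of "cmod (deriv ?g z)"] using d1 d2 D by (intro mult_mono) auto
      also have "\<dots> = (D * ?x * inverse (cmod z))\<^sup>2"
        by (simp add: power2_eq_square divide_inverse mult_ac)
      finally have "cmod (deriv ?g z) \<le> D * ?x * inverse (cmod z)"
        by (rule power2_le_imp_le) (use D in simp)
      also have "\<dots> \<le> D * ?x * (1 + \<Delta>)" using zinv D by (intro mult_left_mono) auto
      finally have d3: "cmod (deriv ?g z) \<le> D * (1 + \<Delta>) * ?x" by (simp add: mult_ac)
      have "D * 1 \<le> D * (1 + \<Delta>)" using D \<Delta> by (intro mult_left_mono) auto
      then have "cmod (deriv ?g z) \<le> D * (1 + \<Delta>) * min 1 ?x" using d1 d3 by (auto simp: min_def)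
      also have "\<dots> \<le> D * (1 + \<Delta>) * ?P"
        using gpos[OF z] n2 D \<Delta> by (intro mult_left_mono le_powr_one_minus) auto
      finally show "cmod (deriv ?g z) \<le> real (2 * n) * (D * (1 + \<Delta>) / (2 * real n)) * ?P"
        using npos by simp
    qed
  qed
  moreover have "H b0 b1 cm1 c0 n z = 0 \<longleftrightarrow> z ^ (2 * n) = ?g z" if "z \<in> cball \<zeta> r" for z
  proof -
    have "dist u z \<le> cmod (\<zeta> - u) + r"
      using dist_triangle[of u z \<zeta>] that by (simp add: dist_norm norm_minus_commute)
    moreover have "(C + 1) / (2 * real n) \<le> \<Delta>" using Cn C npos by (simp add: field_simps)
    ultimately have "z \<in> annulus \<Delta>" using reach by (intro u_ann) auto
    then have "poly (p_rev b0 b1 cm1 c0) z \<noteq> 0" using gpos by (auto simp: g_def)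
    moreover have "H b0 b1 cm1 c0 n z
        = z ^ (2 * n) * poly (p_rev b0 b1 cm1 c0) z - poly (p b0 b1 cm1 c0) z"
      by (simp only: H_def poly_p poly_p_rev mult.assoc)
    ultimately show ?thesis by (simp add: g_def eq_divide_eq)
  qed
  ultimately show ?thesis unfolding \<zeta>_def[symmetric] r_def[symmetric] by metis
qed

section \<open>Phase roots and roots of H\<close>

theorem theorem3p12:
  fixes b0 b1 cm1 c0 :: complex and n :: nat
    and R \<Psi> :: "real \<Rightarrow> real" and \<Delta> C D :: real
  assumes "n \<ge> 1"
    and "\<And>t. R differentiable (at t)"
    and "\<And>t. \<Psi> differentiable (at t)"
    and "\<And>t. R t = cmod (g b0 b1 cm1 c0 (cis t))"
    and "\<And>t. g b0 b1 cm1 c0 (cis t) = of_real (R t) * cis (\<Psi> t)"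
    and "0 < \<Delta>" and "\<Delta> < 1" and "C > 1" and "D > 0"
    and "\<And>z. z \<in> annulus \<Delta> \<Longrightarrow>
           inverse C < cmod (g b0 b1 cm1 c0 z) \<and> cmod (g b0 b1 cm1 c0 z) < C"
    and "\<And>z. z \<in> annulus \<Delta> \<Longrightarrow> cmod (deriv (g b0 b1 cm1 c0) z) < D"
    and "\<And>z. cmod z = 1 \<Longrightarrow> poly (p b0 b1 cm1 c0) z \<noteq> 0 \<and> poly (p_rev b0 b1 cm1 c0) z \<noteq> 0"
    and "real n > max (C * D / (2 * (1 - \<Delta>))) (C / \<Delta>)"
  shows "\<exists>t :: nat \<Rightarrow> real.
           strict_mono_on {1..2 * n + 4 - 2 * Q b0 b1 cm1 c0} t \<and>
           t ` {1..2 * n + 4 - 2 * Q b0 b1 cm1 c0} = phase_roots n \<Psi> \<and>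
           (\<forall>k \<in> {1..2 * n + 4 - 2 * Q b0 b1 cm1 c0}.
              \<exists>!z. z \<in> cball (z_star b0 b1 cm1 c0 n (t k)) (C * D / (2 * (1 - \<Delta>) * real n ^ 2))
                   \<and> H b0 b1 cm1 c0 n z = 0)"
proof -
  note R_diff = assms(2) and \<Psi>_diff = assms(3) and R = assms(4) and polar = assms(5)
    and \<Delta> = assms(6,7) and C = assms(8) and D = assms(9) and gC = assms(10) and gD = assms(11)
    and circle = assms(12)
  let ?g = "g b0 b1 cm1 c0" and ?Q = "Q b0 b1 cm1 c0"
  have n: "real n > C * D / (2 * (1 - \<Delta>))" "real n > C / \<Delta>" using assms(13) by auto
  define \<phi> where "\<phi> t = (2 * real n * t - \<Psi> t) / (2 * pi)" for t
  have contR: "continuous_on UNIV R" and cont\<Psi>: "continuous_on UNIV \<Psi>"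
    using R_diff \<Psi>_diff
    by (auto intro!: continuous_at_imp_continuous_on differentiable_imp_continuous_within)
  have \<phi>_mono: "\<phi> x < \<phi> y" if "x < y" for x y
  proof (rule DERIV_pos_imp_increasing[OF that])
    fix s
    have A: "cis s \<in> annulus \<Delta>" using \<Delta> by (simp add: annulus_def)
    have "C > 0" using C by simp
    have Rlow: "inverse C < R s" using gC[OF A] by (simp add: R)
    have "inverse C > 0" using \<open>C > 0\<close> by simp
    then have nz: "?g (cis s) \<noteq> 0" and Rpos: "R s > 0" using Rlow R[of s] by auto
    have "\<bar>R s * deriv \<Psi> s\<bar> \<le> cmod (deriv ?g (cis s))"
      by (rule phase_derivative_bound[OF R_diff \<Psi>_diff polar g_has_deriv[OF nz]])
    then have "R s * \<bar>deriv \<Psi> s\<bar> < D" using gD[OF A] Rpos by (simp add: abs_mult)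
    moreover have "inverse C * \<bar>deriv \<Psi> s\<bar> \<le> R s * \<bar>deriv \<Psi> s\<bar>"
      using Rlow by (intro mult_right_mono) auto
    ultimately have "inverse C * \<bar>deriv \<Psi> s\<bar> < D" by linarith
    then have "\<bar>deriv \<Psi> s\<bar> < C * D" using \<open>C > 0\<close> by (simp add: field_simps)
    moreover have "C * D < 2 * real n"
    proof -
      have "C * D < 2 * ((1 - \<Delta>) * real n)" using n \<Delta> by (simp add: field_simps)
      also have "(1 - \<Delta>) * real n \<le> 1 * real n" using \<Delta> by (intro mult_right_mono) auto
      finally show ?thesis by simp
    qed
    ultimately have "(2 * real n - deriv \<Psi> s) / (2 * pi) > 0" by simp
    moreover have "(\<Psi> has_real_derivative deriv \<Psi> s) (at s)"
      using \<Psi>_diff by (simp add: DERIV_deriv_iff_real_differentiable)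
    then have "((\<lambda>t. 2 * real n * t - \<Psi> t) has_real_derivative 2 * real n - deriv \<Psi> s) (at s)"
      by (auto intro!: derivative_eq_intros)
    then have "(\<phi> has_real_derivative (2 * real n - deriv \<Psi> s) / (2 * pi)) (at s)"
      unfolding \<phi>_def by (rule DERIV_cdivide)
    ultimately show "\<exists>y. (\<phi> has_real_derivative y) (at s) \<and> 0 < y" by blast
  qed
  have "\<phi> (2 * pi) - \<phi> 0 = (2 * real n * (2 * pi) - (\<Psi> (2 * pi) - \<Psi> 0)) / (2 * pi)"
    by (simp add: \<phi>_def diff_divide_distrib)
  also have "\<Psi> (2 * pi) - \<Psi> 0 = 2 * pi * (2 * real ?Q - 4)"
    by (rule phase_increment[OF cont\<Psi> contR R polar circle])
  also have "(2 * real n * (2 * pi) - 2 * pi * (2 * real ?Q - 4)) / (2 * pi)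
      = 2 * pi * (2 * real n + 4 - 2 * real ?Q) / (2 * pi)"
    by (simp only: algebra_simps)
  finally have total: "\<phi> (2 * pi) - \<phi> 0 = 2 * real n + 4 - 2 * real ?Q" by simp
  \<comment> \<open>Monotonicity makes the total increment positive, so the truncated subtraction is exact.\<close>
  have "2 * ?Q \<le> 2 * n + 4" using total \<phi>_mono[of 0 "2 * pi"] by simp
  then have total': "\<phi> (2 * pi) - \<phi> 0 = real (2 * n + 4 - 2 * ?Q)" using total by (simp add: of_nat_diff)
  have "continuous_on {0..2 * pi} \<phi>"
    unfolding \<phi>_def using continuous_on_subset[OF cont\<Psi>] by (intro continuous_intros) auto
  then obtain t where t: "strict_mono_on {1..2 * n + 4 - 2 * ?Q} t"
      "t ` {1..2 * n + 4 - 2 * ?Q} = {x \<in> {0..<2 * pi}. \<phi> x \<in> \<int>}"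
    by (rule enumerate_integer_crossings[OF _ _ \<phi>_mono total', rotated]) auto
  have roots: "{x \<in> {0..<2 * pi}. \<phi> x \<in> \<int>} = phase_roots n \<Psi>"
    by (simp add: phase_roots_def \<phi>_def cis_eq_cis_iff)
  have "\<exists>!z. z \<in> cball (z_star b0 b1 cm1 c0 n s) (C * D / (2 * (1 - \<Delta>) * real n ^ 2))
                   \<and> H b0 b1 cm1 c0 n z = 0" if "s \<in> phase_roots n \<Psi>" for s
  proof (rule unique_root_in_disc[OF \<Delta> C D gC gD n])
    show "?g (cis s) = of_real (cmod (?g (cis s))) * cis (2 * real n * s)"
      using that polar[of s] R[of s] by (simp add: phase_roots_def)
  qed
  then show ?thesis using t roots by (intro exI[of _ t]) blast
qed

end
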